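(* For any $(s_0,b_0,b_1,s_1)\in\Theta$ and any almost continuous $\kappa\in\mathcal K$, the set ${}^0\!\mathcal A^{\mathbb R^D}$ is a shift-invariant dense $G_\delta$ subset of ${}^1\!\mathcal A^{\mathbb R^D}$, where ${}^1\!\mathcal A^{\mathbb R^D}$ carries the $L^1$ metric.
   Context: Let $D\ge 1$, let $\lambda$ be Lebesgue measure on $\mathbb R^D$, and $L^1=L^1(\mathbb R^D,\lambda)$. $\mathcal A^{\mathbb R^D}$ denotes the set of Borel-measurable functions $\mathbf a:\mathbb R^D\to\{0,1\}$, and ${}^1\!\mathcal A^{\mathbb R^D}=\mathcal A^{\mathbb R^D}\cap L^1$, with metric $\|\mathbf a-\mathbf a'\|_1$. $\mathcal K$ is the set of $\kappa\in L^\infty(\mathbb R^D;[0,\infty))$ with compact support and $\int\kappa\,d\lambda=1$. Convolution: $(\kappa*\mathbf a)(x)=\int\kappa(y)\mathbf a(x-y)\,d\lambda(y)$. $\Theta=\{(s_0,b_0,b_1,s_1): 0<s_0\le b_0<b_1\le s_1\le 1\}$. For $\mathbf a\in{}^1\!\mathcal A^{\mathbb R^D}$ let $M(\mathbf a)=\lambda\{x:\kappa*\mathbf a(x)\in\{s_0,b_0,b_1,s_1\}\}$, and ${}^0\!\mathcal A^{\mathbb R^D}=\{\mathbf a\in{}^1\!\mathcal A^{\mathbb R^D}: M(\mathbf a)=0\}$. For $v\in\mathbb R^D$, the shift is $\sigma^v(\mathbf a)(x)=\mathbf a(x+v)$; a set is shift-invariant if it is mapped to itself by every $\sigma^v$,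 $v\in\mathbb R^D$. For $\mathbf T\subset\mathbb R^D$ and $\gamma>0$ let $\mathbb B(\mathbf T,\gamma)=\{x: d(x,\mathbf T)<\gamma\}$. $\mathbf T$ is thin if $\lim_{\gamma\to0}\lambda[\mathbb B(\mathbf T,\gamma)]=0$. The kernel $\kappa$ is almost continuous if there is a thin set $\mathbf T\subset\mathbb R^D$ such that for every $\gamma>0$, $\kappa$ is uniformly continuous on the complement of $\mathbb B(\mathbf T,\gamma)$. *)

theory Defs
  imports "HOL-Analysis.Analysis"
begin

definition Theta :: "(real \<times> real \<times> real \<times> real) set" where
  "Theta = {(s0, b0, b1, s1). 0 < s0 \<and> s0 \<le> b0 \<and> b0 < b1 \<and> b1 \<le> s1 \<and> s1 \<le> 1}"

text \<open>Elements of $L^\infty$ are represented by functions, and all conditions on them except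
  measurability are required almost everywhere. In particular a kernel has compact support if it
  vanishes almost everywhere outside some compact set.\<close>

definition kernels :: "(real ^ 'n \<Rightarrow> real) set" where
  "kernels = {\<kappa>. \<kappa> \<in> borel_measurable lebesgue
      \<and> (AE x in lebesgue. 0 \<le> \<kappa> x)
      \<and> (\<exists>C. AE x in lebesgue. \<bar>\<kappa> x\<bar> \<le> C)
      \<and> (\<exists>S. compact S \<and> (AE x in lebesgue. x \<notin> S \<longrightarrow> \<kappa> x = 0))
      \<and> (LINT x|lebesgue. \<kappa> x) = 1}"

text \<open>The guard implements $d(x,\emptyset) = \infty$; the library has
  \<^term>\<open>infdist x {} = 0\<close>.\<close>

definition nbhd :: "(real ^ 'n) set \<Rightarrow> real \<Rightarrow> (real ^ 'n) set" where
  "nbhd T \<gamma> = {x. T \<noteq> {} \<and> infdist x T < \<gamma>}"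

definition thin :: "(real ^ 'n) set \<Rightarrow> bool" where
  "thin T \<longleftrightarrow> ((\<lambda>\<gamma>. emeasure lebesgue (nbhd T \<gamma>)) \<longlongrightarrow> 0) (at_right 0)"

definition almost_continuous :: "(real ^ 'n \<Rightarrow> real) \<Rightarrow> bool" where
  "almost_continuous \<kappa> \<longleftrightarrow>
     (\<exists>T. thin T \<and> (\<forall>\<gamma>>0. uniformly_continuous_on (- nbhd T \<gamma>) \<kappa>))"

definition convol :: "(real ^ 'n \<Rightarrow> real) \<Rightarrow> (real ^ 'n \<Rightarrow> real) \<Rightarrow> real ^ 'n \<Rightarrow> real" where
  "convol \<kappa> a x = (LINT y|lebesgue. \<kappa> y * a (x - y))"

definition A_all :: "(real ^ 'n \<Rightarrow> real) set" where
  "A_all = {a \<in> borel_measurable borel. \<forall>x. a x \<in> {0, 1}}"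

definition A_one :: "(real ^ 'n \<Rightarrow> real) set" where
  "A_one = {a \<in> A_all. integrable lebesgue a}"

definition level_mass ::
  "(real ^ 'n \<Rightarrow> real) \<Rightarrow> real \<times> real \<times> real \<times> real \<Rightarrow> (real ^ 'n \<Rightarrow> real) \<Rightarrow> ennreal" where
  "level_mass \<kappa> \<theta> a =
     (case \<theta> of (s0, b0, b1, s1) \<Rightarrow> emeasure lebesgue {x. convol \<kappa> a x \<in> {s0, b0, b1, s1}})"

definition A_zero ::
  "(real ^ 'n \<Rightarrow> real) \<Rightarrow> real \<times> real \<times> real \<times> real \<Rightarrow> (real ^ 'n \<Rightarrow> real) set" where
  "A_zero \<kappa> \<theta> = {a \<in> A_one. level_mass \<kappa> \<theta> a = 0}"

definition shift :: "real ^ 'n \<Rightarrow> (real ^ 'n \<Rightarrow> real) \<Rightarrow> real ^ 'n \<Rightarrow> real" where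
  "shift v a = (\<lambda>x. a (x + v))"

text \<open>The $L^1$ distance is a metric only after identifying functions that agree almost everywhere.
  So \<open>A_one // ae_rel\<close> is the metric space under study, and \<open>A_zero \<kappa> \<theta> // ae_rel\<close> is the
  corresponding subset. No information is lost: \<open>A_zero \<kappa> \<theta>\<close> is a union of classes, see
  \<open>A_zero_saturated\<close> below.\<close>

definition ae_rel :: "((real ^ 'n \<Rightarrow> real) \<times> (real ^ 'n \<Rightarrow> real)) set" where
  "ae_rel = {(a, b). a \<in> A_one \<and> b \<in> A_one \<and> (AE x in lebesgue. a x = b x)}"

definition l1_dist :: "(real ^ 'n \<Rightarrow> real) \<Rightarrow> (real ^ 'n \<Rightarrow> real) \<Rightarrow> real" where
  "l1_dist a b = (LINT x|lebesgue. \<bar>a x - b x\<bar>)"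

text \<open>The value does not depend on the chosen representatives, see \<open>class_dist_eq\<close> below.\<close>

definition class_dist :: "(real ^ 'n \<Rightarrow> real) set \<Rightarrow> (real ^ 'n \<Rightarrow> real) set \<Rightarrow> real" where
  "class_dist X Y = l1_dist (SOME a. a \<in> X) (SOME b. b \<in> Y)"

abbreviation A_one_topology :: "(real ^ 'n \<Rightarrow> real) set topology" where
  "A_one_topology \<equiv> Metric_space.mtopology (A_one // ae_rel) class_dist"

text \<open>A shift acts on a class by shifting its members.\<close>

definition shift_invariant :: "(real ^ 'n \<Rightarrow> real) set set \<Rightarrow> bool" where
  "shift_invariant S \<longleftrightarrow> (\<forall>v. (\<lambda>X. shift v ` X) ` S = S)"

lemma equiv_ae_rel: "equiv A_one ae_rel"
proof (rule equivI)
  show "ae_rel \<subseteq> A_one \<times> A_one" by (auto simp: ae_rel_def)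
  show "refl_on A_one ae_rel" by (auto simp: refl_on_def ae_rel_def)
  show "sym ae_rel"
    by (auto simp: sym_def ae_rel_def elim: eventually_mono)
  show "trans ae_rel"
  proof (rule transI)
    fix a b c :: "real ^ 'n \<Rightarrow> real"
    assume "(a, b) \<in> ae_rel" "(b, c) \<in> ae_rel"
    moreover from this have "AE x in lebesgue. a x = b x" "AE x in lebesgue. b x = c x"
      by (auto simp: ae_rel_def)
    then have "AE x in lebesgue. a x = c x" by eventually_elim simp
    ultimately show "(a, c) \<in> ae_rel" by (auto simp: ae_rel_def)
  qed
qed

lemma A_one_measurable: "a \<in> A_one \<Longrightarrow> a \<in> borel_measurable lebesgue"
  by (auto simp: A_one_def)

lemma l1_dist_cong:
  assumes "(a, a') \<in> ae_rel" "(b, b') \<in> ae_rel"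
  shows "l1_dist a b = l1_dist a' b'"
  unfolding l1_dist_def
proof (rule integral_cong_AE)
  have m: "a \<in> A_one" "a' \<in> A_one" "b \<in> A_one" "b' \<in> A_one"
    using assms by (auto simp: ae_rel_def)
  note [measurable] = m[THEN A_one_measurable]
  show "(\<lambda>x. \<bar>a x - b x\<bar>) \<in> borel_measurable lebesgue" by measurable
  show "(\<lambda>x. \<bar>a' x - b' x\<bar>) \<in> borel_measurable lebesgue" by measurable
  have "AE x in lebesgue. a x = a' x" "AE x in lebesgue. b x = b' x"
    using assms by (auto simp: ae_rel_def)
  then show "AE x in lebesgue. \<bar>a x - b x\<bar> = \<bar>a' x - b' x\<bar>" by eventually_elim simp
qed

lemma class_dist_eq:
  assumes "X \<in> A_one // ae_rel" "Y \<in> A_one // ae_rel" "a \<in> X" "b \<in> Y"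
  shows "class_dist X Y = l1_dist a b"
proof -
  have "(SOME a. a \<in> X) \<in> X" "(SOME b. b \<in> Y) \<in> Y"
    using someI[of "\<lambda>a. a \<in> X"] someI[of "\<lambda>b. b \<in> Y"] assms(3,4) by auto
  then have "((SOME a. a \<in> X), a) \<in> ae_rel" "((SOME b. b \<in> Y), b) \<in> ae_rel"
    using assms equiv_ae_rel by (metis in_quotient_imp_in_rel insert_subset empty_subsetI)+
  then show ?thesis unfolding class_dist_def by (rule l1_dist_cong)
qed

lemma Metric_space_A_one: "Metric_space (A_one // ae_rel) class_dist"
proof
  have integ: "integrable lebesgue (\<lambda>x. \<bar>a x - b x\<bar>)" if "a \<in> A_one" "b \<in> A_one"
    for a b :: "real ^ 'n \<Rightarrow> real"
    using that by (auto simp: A_one_def)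
  have rep: "\<exists>a. a \<in> X \<and> a \<in> A_one" if "X \<in> A_one // ae_rel" for X :: "(real ^ 'n \<Rightarrow> real) set"
    using that equiv_ae_rel by (metis equiv_class_self quotientE)
  fix X Y Z :: "(real ^ 'n \<Rightarrow> real) set"
  show "0 \<le> class_dist X Y" by (simp add: class_dist_def l1_dist_def)
  show "class_dist X Y = class_dist Y X"
    by (simp add: class_dist_def l1_dist_def abs_minus_commute)
  assume X: "X \<in> A_one // ae_rel" and Y: "Y \<in> A_one // ae_rel"
  obtain a b where a: "a \<in> X" "a \<in> A_one" and b: "b \<in> Y" "b \<in> A_one"
    using rep X Y by meson
  have "class_dist X Y = 0 \<longleftrightarrow> (AE x in lebesgue. \<bar>a x - b x\<bar> = 0)"
    unfolding class_dist_eq[OF X Y a(1) b(1)] l1_dist_def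
    by (rule integral_nonneg_eq_0_iff_AE) (use integ a b in auto)
  also have "\<dots> \<longleftrightarrow> (a, b) \<in> ae_rel" using a b by (simp add: ae_rel_def)
  also have "\<dots> \<longleftrightarrow> X = Y"
    using quotient_eq_iff[OF equiv_ae_rel X Y a(1) b(1)] by simp
  finally show "class_dist X Y = 0 \<longleftrightarrow> X = Y" .
  assume Z: "Z \<in> A_one // ae_rel"
  obtain c where c: "c \<in> Z" "c \<in> A_one" using rep Z by meson
  have "l1_dist a c \<le> (LINT x|lebesgue. \<bar>a x - b x\<bar> + \<bar>b x - c x\<bar>)"
    unfolding l1_dist_def
    by (rule integral_mono[OF integ[OF a(2) c(2)] Bochner_Integration.integrable_add])
      (use integ a b c in auto)
  also have "\<dots> = l1_dist a b + l1_dist b c"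
    unfolding l1_dist_def by (rule Bochner_Integration.integral_add) (use integ a b c in auto)
  finally show "class_dist X Z \<le> class_dist X Y + class_dist Y Z"
    using class_dist_eq X Y Z a b c by metis
qed

lemma A_zero_saturated:
  fixes \<kappa> :: "real ^ 'n \<Rightarrow> real"
  assumes \<kappa>: "\<kappa> \<in> kernels" and a: "a \<in> A_zero \<kappa> \<theta>" and ab: "(a, b) \<in> ae_rel"
  shows "b \<in> A_zero \<kappa> \<theta>"
proof -
  have A: "a \<in> A_one" "b \<in> A_one" and AE: "AE x in lebesgue. a x = b x"
    using ab by (auto simp: ae_rel_def)
  have [measurable]: "a \<in> borel_measurable borel" "b \<in> borel_measurable borel"
    using A by (auto simp: A_one_def A_all_def)
  have [measurable]: "\<kappa> \<in> borel_measurable lebesgue" using \<kappa> by (auto simp: kernels_def)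
  have "convol \<kappa> a x = convol \<kappa> b x" for x
    unfolding convol_def
  proof (rule integral_cong_AE)
    have m: "(\<lambda>y. c (x - y)) \<in> borel_measurable lebesgue"
      if [measurable]: "c \<in> borel_measurable borel" for c :: "real ^ 'n \<Rightarrow> real"
    proof -
      have "(\<lambda>y. c (x - y)) \<in> borel_measurable lborel" by measurable
      then show ?thesis by (rule measurable_completion)
    qed
    show "(\<lambda>y. \<kappa> y * a (x - y)) \<in> borel_measurable lebesgue"
      "(\<lambda>y. \<kappa> y * b (x - y)) \<in> borel_measurable lebesgue"
      using m[of a] m[of b] by (auto intro!: borel_measurable_times)
    have "AE y in lborel. a y = b y" using AE by (simp add: AE_completion_iff)
    moreover have "lborel = distr lborel borel (\<lambda>y. x - y)"
      using lborel_affine[of "-1" x] by (simp add: density_1)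
    ultimately have "AE y in distr lborel borel (\<lambda>y. x - y). a y = b y" by metis
    then have "AE y in lborel. a (x - y) = b (x - y)"
      by (subst (asm) AE_distr_iff) auto
    then have "AE y in lebesgue. a (x - y) = b (x - y)" by (simp add: AE_completion_iff)
    then show "AE y in lebesgue. \<kappa> y * a (x - y) = \<kappa> y * b (x - y)" by eventually_elim simp
  qed
  then show ?thesis using a A by (simp add: A_zero_def level_mass_def)
qed

end

theory Submission
  imports Defs
begin

text \<open>Convolution with a bounded kernel is Lipschitz from the $L^1$ distance to the uniform norm, and
  the superlevel sets of $\kappa * a$ at positive levels have finite measure. Hence the level mass is
  upper semicontinuous, and its zero set is a $G_\delta$.

  For density, replace $a$ by the indicator of an open set $U$ of finite measure, and remove from $U$
  a chain of small sets $S_t$, indexed by the real numbers, such that $S_t \setminus S_s$ meets every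
  nonempty open set in positive measure whenever $s < t$. Almost continuity makes the set where $\kappa$
  is positive open up to a null set, so $\kappa * 1_{U \setminus S_t}(x)$ is strictly decreasing in $t$
  as long as it is positive. The level sets of a fixed level are therefore disjoint for different $t$,
  and only countably many of them can have positive measure.\<close>

section \<open>A strictly increasing chain of small sets\<close>

lemma emeasure_lborel_open_pos:
  fixes V :: "'a::euclidean_space set"
  assumes "open V" "V \<noteq> {}"
  shows "0 < emeasure lborel V"
  using open_not_negligible[OF assms] assms(1) negligible_iff_emeasure0[of V]
  by (auto simp: zero_less_iff_neq_zero)

text \<open>A small ball around a point of \<open>V\<close> already has measure below
  \<open>e\<close>. Deleting the null set \<open>D\<close> does not change that measure, and inner
  regularity then yields a closed set that is still not null.\<close>

lemma ex_compact_avoiding_countable: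
  fixes V :: "'a::euclidean_space set"
  assumes V: "open V" "V \<noteq> {}" and D: "countable D" and e: "0 < (e::real)"
  shows "\<exists>K. compact K \<and> K \<subseteq> V - D \<and> 0 < emeasure lborel K \<and> emeasure lborel K < e"
proof -
  obtain x where x: "x \<in> V" using V by auto
  \<comment> \<open>A point is a null set, so outer regularity gives it open neighbourhoods of
    arbitrarily small measure.\<close>
  obtain W where W: "open W" "{x} \<subseteq> W" "emeasure lborel (W - {x}) < e"
    using outer_regular_lborel[of "{x}" e] e by auto
  have "emeasure lborel W = emeasure lborel (W - {x})"
    using W by (intro emeasure_Diff_null_set[symmetric]) auto
  then have We: "emeasure lborel W < e" using W by simp
  obtain r where r: "0 < r" "ball x r \<subseteq> V \<inter> W"
    using x W V open_contains_ball[of "V \<inter> W"] by (metis IntI insert_subset open_Int)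
  define B where "B = ball x r - D"
  have nD: "D \<in> null_sets lborel" using D by (rule countable_imp_null_set_lborel)
  then have [measurable]: "D \<in> sets borel" by auto
  have B[measurable]: "B \<in> sets borel" by (simp add: B_def)
  then have Bl: "B \<in> sets lebesgue" by simp
  have eB: "emeasure lborel B = emeasure lborel (ball x r)"
    unfolding B_def by (rule emeasure_Diff_null_set) (use nD in auto)
  have Bpos: "0 < emeasure lborel B"
    unfolding eB using r by (intro emeasure_lborel_open_pos) auto
  have "emeasure lborel B < \<infinity>" unfolding eB using emeasure_bounded_finite[OF bounded_ball] by auto
  then obtain m where m: "emeasure lborel B = ennreal m" "0 < m"
    using Bpos by (metis ennreal_cases ennreal_less_zero_iff infinity_ennreal_def less_irrefl)
  \<comment> \<open>The permitted error is the whole measure \<open>m\<close> of \<open>B\<close>;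
    since it is not attained, \<open>K\<close> cannot be null.\<close>
  obtain K where K: "closed K" "K \<subseteq> B" "emeasure lebesgue (B - K) < ennreal m"
    using sets_lebesgue_inner_closed[OF Bl m(2)] by metis
  have [measurable]: "K \<in> sets borel" using K by auto
  have "bounded K" using K(2) unfolding B_def by (meson Diff_subset bounded_ball bounded_subset)
  then have "compact K" using K by (simp add: compact_eq_bounded_closed)
  moreover have "K \<subseteq> V - D" using K r by (auto simp: B_def)
  moreover have "emeasure lborel K \<noteq> 0"
  proof
    assume "emeasure lborel K = 0"
    then have "emeasure lborel (B - K) = emeasure lborel B"
      by (intro emeasure_Diff_null_set) auto
    then show False using K(3) m by simp
  qed
  then have "0 < emeasure lborel K" by (simp add: zero_less_iff_neq_zero)
  moreover have "emeasure lborel K \<le> emeasure lborel W"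
    by (rule emeasure_mono) (use K r W in \<open>auto simp: B_def\<close>)
  then have "emeasure lborel K < e" using We by simp
  ultimately show ?thesis by blast
qed

text \<open>Keeping all the compact sets disjoint from a countable dense set makes every finite union of
  them closed with dense complement, so there is room for the next one.\<close>

lemma ex_disjoint_compact_sequence:
  fixes V :: "nat \<Rightarrow> 'a::euclidean_space set"
  assumes V: "\<And>m. open (V m)" "\<And>m. V m \<noteq> {}" and e: "\<And>m. 0 < (e m :: real)"
  obtains K where "\<And>m. compact (K m)" "\<And>m. K m \<subseteq> V m" "disjoint_family K"
    "\<And>m. 0 < emeasure lborel (K m)" "\<And>m. emeasure lborel (K m) < e m"
proof -
  obtain D :: "'a set" where D: "countable D" "\<And>X. open X \<Longrightarrow> X \<noteq> {} \<Longrightarrow> \<exists>d\<in>D. d \<in> X"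
    using countable_dense_exists by metis
  \<comment> \<open>\<open>F m\<close> is the union of the first \<open>m\<close> compact sets. The
    invariant of the recursion is that \<open>F m\<close> is closed and misses \<open>D\<close>; the
    wanted sets are the successive differences.\<close>
  have "\<exists>F. \<forall>m. (closed (F m) \<and> F m \<inter> D = {}) \<and>
      (F m \<subseteq> F (Suc m) \<and> compact (F (Suc m) - F m) \<and> F (Suc m) - F m \<subseteq> V m
        \<and> 0 < emeasure lborel (F (Suc m) - F m) \<and> emeasure lborel (F (Suc m) - F m) < e m)"
  proof (rule dependent_nat_choice)
    show "\<exists>F. closed F \<and> F \<inter> D = {}" by (rule exI[of _ "{}"]) auto
  next
    fix F :: "'a set" and m
    assume F: "closed F \<and> F \<inter> D = {}"
    obtain d where "d \<in> D" "d \<in> V m" using D(2)[OF V(1) V(2)] by blast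
    then have "open (V m - F)" "V m - F \<noteq> {}" using V F by auto
    then obtain K where K: "compact K" "K \<subseteq> V m - F - D"
        "0 < emeasure lborel K" "emeasure lborel K < e m"
      using ex_compact_avoiding_countable[OF _ _ D(1) e, of "V m - F" m] by blast
    have "(F \<union> K) - F = K" using K by auto
    moreover have "closed (F \<union> K)" using F K by (simp add: closed_Un compact_imp_closed)
    ultimately show "\<exists>F'. (closed F' \<and> F' \<inter> D = {}) \<and> F \<subseteq> F' \<and> compact (F' - F)
        \<and> F' - F \<subseteq> V m \<and> 0 < emeasure lborel (F' - F) \<and> emeasure lborel (F' - F) < e m"
      using F K by (intro exI[of _ "F \<union> K"] conjI) (simp_all, auto)
  qed
  then obtain F where F: "\<And>m. F m \<subseteq> F (Suc m)" "\<And>m. compact (F (Suc m) - F m)"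
      "\<And>m. F (Suc m) - F m \<subseteq> V m" "\<And>m. 0 < emeasure lborel (F (Suc m) - F m)"
      "\<And>m. emeasure lborel (F (Suc m) - F m) < e m"
    by metis
  have "disjoint_family (\<lambda>m. F (Suc m) - F m)"
    using F(1) by (rule disjoint_family_Suc)
  with F(2-) show thesis by (intro that[of "\<lambda>m. F (Suc m) - F m"])
qed

text \<open>For each pair of a nonempty basic open set and a rational \<open>q\<close>, a compact
  set is placed in the basic set, all of them disjoint; \<open>S t\<close> collects those with
  \<open>q < t\<close>. A rational between \<open>s\<close> and \<open>t\<close>, paired with a
  basic set inside \<open>V\<close>, witnesses the strict increase.\<close>

lemma ex_strict_chain:
  assumes e: "0 < (e::real)"
  obtains S :: "real \<Rightarrow> 'a::euclidean_space set"
  where "\<And>t. S t \<in> sets borel" "\<And>t. emeasure lborel (S t) \<le> e" "\<And>s t. s \<le> t \<Longrightarrow> S s \<subseteq> S t"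
    "\<And>s t V. s < t \<Longrightarrow> open V \<Longrightarrow> V \<noteq> {} \<Longrightarrow> 0 < emeasure lborel (V \<inter> (S t - S s))"
proof -
  obtain B :: "'a set set" where B: "countable B" "topological_basis B"
    using ex_countable_basis by metis
  define P where "P = (B - {{}}) \<times> (\<rat> :: real set)"
  have Pc: "countable P" using B by (simp add: P_def countable_rat)
  have "\<exists>b\<in>B. b \<noteq> {}"
    using topological_basisE[OF B(2) open_UNIV UNIV_I] by (metis empty_iff)
  then have Pne: "P \<noteq> {}" by (auto simp: P_def)
  define p where "p = from_nat_into P"
  have p: "p m \<in> P" for m unfolding p_def by (rule from_nat_into[OF Pne])
  have Vp: "open (fst (p m))" "fst (p m) \<noteq> {}" for m
    using p[of m] topological_basis_open[OF B(2)] by (auto simp: P_def)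
  \<comment> \<open>The bounds form a geometric series with sum \<open>e\<close>, which bounds every
    \<open>S t\<close> at once.\<close>
  have epos: "0 < e * (1/2) ^ Suc m" for m using e by simp
  obtain K where K: "\<And>m. compact (K m)" "\<And>m. K m \<subseteq> fst (p m)" "disjoint_family K"
    "\<And>m. 0 < emeasure lborel (K m)" "\<And>m. emeasure lborel (K m) < ennreal (e * (1/2) ^ Suc m)"
    using ex_disjoint_compact_sequence[where V = "\<lambda>m. fst (p m)" and e = "\<lambda>m. e * (1/2) ^ Suc m", OF Vp epos]
    by blast
  have Kb[measurable]: "K m \<in> sets borel" for m using K(1) by (simp add: borel_compact)
  define S where "S t = (\<Union>m\<in>{m. snd (p m) < t}. K m)" for t
  have Sb[measurable]: "S t \<in> sets borel" for t
    unfolding S_def by (rule sets.countable_UN'') auto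
  show thesis
  proof
    show "S t \<in> sets borel" for t by (rule Sb)
    show "S s \<subseteq> S t" if "s \<le> t" for s t unfolding S_def using that by (intro UN_mono) auto
    fix t
    have "emeasure lborel (S t) \<le> emeasure lborel (\<Union>m. K m)"
      by (rule emeasure_mono) (auto simp: S_def)
    also have "\<dots> \<le> (\<Sum>m. emeasure lborel (K m))"
      by (rule emeasure_subadditive_countably) auto
    also have "\<dots> \<le> (\<Sum>m. ennreal (e * (1/2) ^ Suc m))"
      by (intro suminf_le) (use K(5) in \<open>auto intro: less_imp_le\<close>)
    also have "\<dots> = ennreal e"
      by (rule suminf_ennreal_eq) (use e sums_mult[OF power_half_series, of e] in auto)
    finally show "emeasure lborel (S t) \<le> e" .
  next
    fix s t :: real and V :: "'a set"
    assume st: "s < t" and V: "open V" "V \<noteq> {}"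
    obtain x where "x \<in> V" using V by auto
    then obtain b where b: "b \<in> B" "x \<in> b" "b \<subseteq> V"
      using topological_basisE[OF B(2) V(1)] by metis
    obtain q where q: "q \<in> \<rat>" "s < q" "q < t" using Rats_dense_in_real[OF st] by auto
    have "(b, q) \<in> P" using b q by (auto simp: P_def)
    then obtain m where m: "p m = (b, q)"
      unfolding p_def using from_nat_into_surj[OF Pc] by blast
    have "K m \<subseteq> V \<inter> (S t - S s)"
    proof
      fix y assume y: "y \<in> K m"
      \<comment> \<open>By disjointness, \<open>K m\<close> is the only set of the family containing
        \<open>y\<close>, and its label \<open>q\<close> exceeds \<open>s\<close>.\<close>
      have "y \<notin> S s"
      proof
        assume "y \<in> S s"
        then obtain j where j: "snd (p j) < s" "y \<in> K j" by (auto simp: S_def)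
        then have "j = m" using y K(3) by (auto simp: disjoint_family_on_def)
        then show False using j m q by simp
      qed
      then show "y \<in> V \<inter> (S t - S s)" using y K(2)[of m] m b q unfolding S_def by force
    qed
    then have "emeasure lborel (K m) \<le> emeasure lborel (V \<inter> (S t - S s))"
      by (rule emeasure_mono) (use V in auto)
    then show "0 < emeasure lborel (V \<inter> (S t - S s))" using K(4)[of m] by simp
  qed
qed

text \<open>Every finite sum of the measures is at most the measure of \<open>B\<close>, so the
  family is summable, and a summable family has only countably many nonzero terms.\<close>

lemma countable_nonnull_disjoint_family:
  assumes meas: "\<And>t. t \<in> I \<Longrightarrow> Z t \<in> sets M" and sub: "\<And>t. t \<in> I \<Longrightarrow> Z t \<subseteq> B"
    and B: "B \<in> sets M" "emeasure M B \<noteq> \<infinity>" and disj: "disjoint_family_on Z I"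
  shows "countable {t \<in> I. emeasure M (Z t) \<noteq> 0}"
proof -
  have fin: "emeasure M (Z t) \<noteq> \<infinity>" if "t \<in> I" for t
    using emeasure_mono[OF sub[OF that] B(1)] B(2) by (auto simp: top_unique)
  have "(\<lambda>t. measure M (Z t)) summable_on I"
  proof (rule nonneg_bdd_above_summable_on)
    show "bdd_above (sum (\<lambda>t. measure M (Z t)) ` {F. F \<subseteq> I \<and> finite F})"
    proof (rule bdd_aboveI2)
      fix F assume "F \<in> {F. F \<subseteq> I \<and> finite F}"
      then have F: "F \<subseteq> I" "finite F" by auto
      have "(\<Sum>t\<in>F. measure M (Z t)) = measure M (\<Union>t\<in>F. Z t)"
        using F meas fin disjoint_family_on_mono[OF F(1) disj]
        by (intro measure_finite_Union[symmetric]) auto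
      also have "\<dots> \<le> measure M B"
        using F meas sub B by (intro measure_mono_fmeasurable fmeasurableI)
          (auto simp: less_top)
      finally show "(\<Sum>t\<in>F. measure M (Z t)) \<le> measure M B" .
    qed
  qed simp
  then have "countable {t \<in> I. measure M (Z t) \<noteq> 0}" by (rule summable_countable_real)
  moreover have "{t \<in> I. emeasure M (Z t) \<noteq> 0} = {t \<in> I. measure M (Z t) \<noteq> 0}"
    using fin by (auto simp: measure_def enn2real_eq_0_iff)
  ultimately show ?thesis by simp
qed

section \<open>Kernels\<close>

text \<open>Kernels satisfy their bounds only almost everywhere and are only Lebesgue measurable. A
  Borel representative with bounds at every point makes the later estimates pointwise.\<close>

lemma bounded_kernel_version:
  fixes \<kappa> :: "real ^ 'n \<Rightarrow> real"
  assumes "\<kappa> \<in> kernels"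
  obtains k C where "k \<in> borel_measurable borel" "\<And>x. 0 \<le> k x" "\<And>x. k x \<le> C"
    "integrable lborel k" "AE x in lborel. \<kappa> x = k x"
proof -
  from assms obtain C where m: "\<kappa> \<in> borel_measurable lebesgue" and
    n: "AE x in lborel. 0 \<le> \<kappa> x" and C: "AE x in lborel. \<bar>\<kappa> x\<bar> \<le> C"
    and i: "(LINT x|lebesgue. \<kappa> x) = 1"
    by (auto simp: kernels_def AE_completion_iff)
  obtain g where [measurable]: "g \<in> borel_measurable lborel" and g: "AE x in lborel. \<kappa> x = g x"
    using completion_ex_borel_measurable_real[OF m] by auto
  \<comment> \<open>Clamping to \<open>[0, \<bar>C\<bar>]\<close> changes \<open>g\<close> only on a
    null set; the absolute value makes the interval nonempty without an argument about the sign of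
    \<open>C\<close>.\<close>
  define k where "k x = max 0 (min \<bar>C\<bar> (g x))" for x
  have [measurable]: "k \<in> borel_measurable borel" unfolding k_def by measurable
  have ae: "AE x in lborel. \<kappa> x = k x"
    using n C g by eventually_elim (auto simp: k_def)
  \<comment> \<open>The integral of a non-integrable function is 0 by default, so the value 1
    implies integrability.\<close>
  have "integrable lebesgue \<kappa>" using i not_integrable_integral_eq by fastforce
  moreover have "k \<in> borel_measurable lebesgue" by (rule measurable_completion) simp
  moreover have "AE x in lebesgue. \<kappa> x = k x" using ae by (rule AE_completion)
  ultimately have "integrable lebesgue k"
    by (metis integrable_cong_AE m)
  then have "integrable lborel k" by (simp add: integrable_completion)
  moreover have "0 \<le> k x" "k x \<le> \<bar>C\<bar>" for x by (auto simp: k_def)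
  ultimately show thesis using ae that[of k "\<bar>C\<bar>"] by simp
qed

text \<open>The closure of \<open>T\<close> lies in every neighbourhood
  \<open>nbhd T \<gamma>\<close> with \<open>\<gamma> > 0\<close>, and the measures of these tend to
  0.\<close>

lemma thin_closure_null:
  fixes T :: "(real ^ 'n) set"
  assumes "thin T"
  shows "closure T \<in> null_sets lborel"
proof -
  have op: "open (nbhd T \<gamma>)" for \<gamma>
    unfolding nbhd_def by (cases "T = {}") (auto intro!: open_Collect_less continuous_intros)
  have le: "emeasure lebesgue (closure T) \<le> emeasure lebesgue (nbhd T \<gamma>)" if "0 < \<gamma>" for \<gamma>
  proof (rule emeasure_mono)
    show "closure T \<subseteq> nbhd T \<gamma>"
    proof
      fix x assume x: "x \<in> closure T"
      then have "T \<noteq> {}" by auto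
      then show "x \<in> nbhd T \<gamma>"
        using that x in_closure_iff_infdist_zero[of T x] by (simp add: nbhd_def)
    qed
    show "nbhd T \<gamma> \<in> sets lebesgue" using op by auto
  qed
  have "emeasure lebesgue (closure T) \<le> 0"
    by (rule tendsto_lowerbound[OF assms[unfolded thin_def]])
      (auto simp: eventually_at_right_field simp del: emeasure_completion intro!: exI[of _ 1] le)
  then show ?thesis by (simp add: null_setsI)
qed

text \<open>A point outside the closure of \<open>T\<close> has positive distance from
  \<open>T\<close>, so \<open>\<kappa>\<close> is continuous there. Its positivity set off the null
  set \<open>closure T\<close> is therefore open.\<close>

lemma almost_continuous_kernel_support:
  fixes \<kappa> :: "real ^ 'n \<Rightarrow> real"
  assumes \<kappa>: "\<kappa> \<in> kernels" and ac: "almost_continuous \<kappa>"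
  obtains P where "open P" "\<And>x. x \<in> P \<Longrightarrow> 0 < \<kappa> x" "AE x in lborel. x \<notin> P \<longrightarrow> \<kappa> x = 0"
proof -
  obtain T where T: "thin T" and uc: "\<And>\<gamma>. 0 < \<gamma> \<Longrightarrow> uniformly_continuous_on (- nbhd T \<gamma>) \<kappa>"
    using ac by (auto simp: almost_continuous_def)
  have cont: "continuous_on (- closure T) \<kappa>"
  proof (cases "T = {}")
    case True
    then show ?thesis
      using uniformly_continuous_imp_continuous[OF uc[of 1]] by (simp add: nbhd_def)
  next
    case False
    have "isCont \<kappa> x" if "x \<in> - closure T" for x
    proof -
      \<comment> \<open>Half the distance leaves an open neighbourhood of \<open>x\<close> inside
        the complement of \<open>nbhd T \<gamma>\<close>.\<close>
      define \<gamma> where "\<gamma> = infdist x T / 2"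
      have "infdist x T \<noteq> 0" using that False in_closure_iff_infdist_zero by blast
      then have \<gamma>: "0 < \<gamma>" "\<gamma> < infdist x T"
        using infdist_nonneg[of x T] by (auto simp: \<gamma>_def)
      have "open {y. \<gamma> < infdist y T}" by (intro open_Collect_less continuous_intros)
      moreover have "{y. \<gamma> < infdist y T} \<subseteq> - nbhd T \<gamma>" by (auto simp: nbhd_def)
      then have "continuous_on {y. \<gamma> < infdist y T} \<kappa>"
        using uniformly_continuous_imp_continuous[OF uc[OF \<gamma>(1)]] continuous_on_subset by blast
      ultimately show ?thesis using \<gamma> by (simp add: continuous_on_eq_continuous_at)
    qed
    then show ?thesis by (simp add: continuous_at_imp_continuous_on)
  qed
  define P where "P = - closure T \<inter> \<kappa> -` {0<..}"
  have "open P" unfolding P_def by (rule continuous_open_preimage[OF cont]) auto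
  moreover have "AE x in lborel. 0 \<le> \<kappa> x" using \<kappa> by (auto simp: kernels_def AE_completion_iff)
  then have "AE x in lborel. x \<notin> P \<longrightarrow> \<kappa> x = 0"
    using AE_not_in[OF thin_closure_null[OF T]] by eventually_elim (auto simp: P_def)
  ultimately show thesis using that[of P] by (simp add: P_def)
qed


section \<open>Convolution\<close>

lemma lborel_distr_reflect: "distr lborel borel (\<lambda>y. x - y) = (lborel :: 'a::euclidean_space measure)"
  using lborel_affine[of "-1" x] by (simp add: density_1)

lemma integral_lborel_reflect:
  fixes x :: "real ^ 'n" and f :: "real ^ 'n \<Rightarrow> real"
  assumes [measurable]: "f \<in> borel_measurable borel"
  shows "(LINT y|lborel. f (x - y)) = (LINT y|lborel. f y)"
  by (subst lborel_distr_reflect[of x, symmetric], subst integral_distr) auto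

lemma integrable_lborel_reflect:
  fixes x :: "real ^ 'n" and f :: "real ^ 'n \<Rightarrow> real"
  assumes "integrable lborel f"
  shows "integrable lborel (\<lambda>y. f (x - y))"
proof -
  have [measurable]: "f \<in> borel_measurable borel" using assms by auto
  have "integrable (distr lborel borel (\<lambda>y. x - y)) f" using assms lborel_distr_reflect by metis
  then show ?thesis by (subst (asm) integrable_distr_eq) auto
qed

lemma emeasure_lborel_reflect:
  fixes x :: "real ^ 'n"
  assumes "B \<in> sets borel"
  shows "emeasure lborel {y. x - y \<in> B} = emeasure lborel B"
proof -
  have "emeasure lborel B = emeasure (distr lborel borel (\<lambda>y. x - y)) B"
    by (simp add: lborel_distr_reflect)
  also have "\<dots> = emeasure lborel {y. x - y \<in> B}"
    by (subst emeasure_distr) (auto simp: assms vimage_def)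
  finally show ?thesis ..
qed

lemma nn_integral_lborel_shift:
  fixes y :: "real ^ 'n"
  assumes [measurable]: "f \<in> borel_measurable borel"
  shows "(\<integral>\<^sup>+x. f (x - y) \<partial>lborel) = (\<integral>\<^sup>+x. f x \<partial>lborel)"
proof -
  have "(\<integral>\<^sup>+x. f x \<partial>lborel) = (\<integral>\<^sup>+x. f x \<partial>distr lborel borel ((+) (- y)))"
    by (simp add: lborel_distr_plus)
  also have "\<dots> = (\<integral>\<^sup>+x. f (x - y) \<partial>lborel)"
    by (subst nn_integral_distr) auto
  finally show ?thesis ..
qed

lemma emeasure_lborel_shift:
  fixes v :: "real ^ 'n"
  assumes "B \<in> sets borel"
  shows "emeasure lborel {x. x + v \<in> B} = emeasure lborel B"
proof -
  have "emeasure lborel B = emeasure (distr lborel borel ((+) v)) B"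
    by (simp add: lborel_distr_plus)
  also have "\<dots> = emeasure lborel {x. x + v \<in> B}"
    by (subst emeasure_distr) (auto simp: assms vimage_def add.commute)
  finally show ?thesis ..
qed

section \<open>Passage from Lebesgue measurable functions to Borel representatives and
  \<open>lborel\<close>\<close>

lemma A_oneD:
  assumes "a \<in> A_one"
  shows "a \<in> borel_measurable borel" "integrable lborel a" "a x = 0 \<or> a x = 1"
    "0 \<le> a x" "a x \<le> 1"
  using assms by (auto simp: A_one_def A_all_def integrable_completion) (metis zero_le_one order_refl)+

lemma indicator_in_A_one:
  assumes "A \<in> sets borel" "emeasure lborel A < \<infinity>"
  shows "indicator A \<in> A_one"
  using assms by (auto simp: A_one_def A_all_def integrable_completion indicator_def)

lemma l1_dist_lborel:
  assumes "a \<in> A_one" "b \<in> A_one"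
  shows "l1_dist a b = (LINT x|lborel. \<bar>a x - b x\<bar>)"
proof -
  note [measurable] = A_oneD(1)[OF assms(1)] A_oneD(1)[OF assms(2)]
  show ?thesis unfolding l1_dist_def by (rule integral_completion) measurable
qed

lemma convol_lborel_cong:
  assumes k[measurable]: "k \<in> borel_measurable borel" and ae: "AE y in lborel. \<kappa> y = k y"
    and \<kappa>: "\<kappa> \<in> borel_measurable lebesgue" and a[measurable]: "a \<in> borel_measurable borel"
  shows "convol \<kappa> a x = (LINT y|lborel. k y * a (x - y))"
proof -
  have "(\<lambda>y. a (x - y)) \<in> borel_measurable lborel" by measurable
  then have [measurable]: "(\<lambda>y. a (x - y)) \<in> borel_measurable lebesgue" by (rule measurable_completion)
  have k': "(\<lambda>y. k y * a (x - y)) \<in> borel_measurable lborel" by measurable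
  have "convol \<kappa> a x = (LINT y|lebesgue. k y * a (x - y))"
    unfolding convol_def
  proof (rule integral_cong_AE)
    show "(\<lambda>y. \<kappa> y * a (x - y)) \<in> borel_measurable lebesgue" using \<kappa> by measurable
    show "(\<lambda>y. k y * a (x - y)) \<in> borel_measurable lebesgue"
      using k' by (rule measurable_completion)
    show "AE y in lebesgue. \<kappa> y * a (x - y) = k y * a (x - y)"
      using AE_completion[OF ae] by eventually_elim simp
  qed
  then show ?thesis using integral_completion[OF k'] by simp
qed

section \<open>Convolution with a fixed bounded Borel kernel\<close>

locale bounded_kernel =
  fixes k :: "real ^ 'n \<Rightarrow> real" and C :: real
  assumes k_measurable[measurable]: "k \<in> borel_measurable borel"
    and k_nonneg: "0 \<le> k x" and k_le: "k x \<le> C" and k_integrable: "integrable lborel k"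
begin

definition conv :: "(real ^ 'n \<Rightarrow> real) \<Rightarrow> real ^ 'n \<Rightarrow> real" where
  "conv a x = (LINT y|lborel. k y * a (x - y))"

lemma C_nonneg: "0 \<le> C"
  using k_nonneg k_le order_trans by blast

lemma integrable_conv:
  assumes [measurable]: "a \<in> borel_measurable borel" and "\<And>x. \<bar>a x\<bar> \<le> 1"
  shows "integrable lborel (\<lambda>y. k y * a (x - y))"
proof (rule Bochner_Integration.integrable_bound[OF k_integrable])
  show "AE y in lborel. norm (k y * a (x - y)) \<le> norm (k y)"
    using assms(2) by (auto simp: abs_mult intro!: mult_left_le)
qed measurable

lemma measurable_conv[measurable]:
  assumes [measurable]: "a \<in> borel_measurable borel"
  shows "conv a \<in> borel_measurable borel"
  unfolding conv_def by measurable

text \<open>The kernel is at most \<open>C\<close>, and Lebesgue measure is invariant under the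
  reflection taking \<open>y\<close> to \<open>x - y\<close>. The bound is uniform in
  \<open>x\<close>, which lets whole level sets be compared.\<close>

lemma conv_diff_le:
  assumes a: "a \<in> A_one" and b: "b \<in> A_one"
  shows "\<bar>conv a x - conv b x\<bar> \<le> C * l1_dist a b"
proof -
  note [measurable] = A_oneD(1)[OF a] A_oneD(1)[OF b]
  have i: "integrable lborel (\<lambda>y. k y * a (x - y))" "integrable lborel (\<lambda>y. k y * b (x - y))"
    using A_oneD(4,5)[OF a] A_oneD(4,5)[OF b] by (auto intro!: integrable_conv)
  have iab: "integrable lborel (\<lambda>y. \<bar>a y - b y\<bar>)" using A_oneD(2)[OF a] A_oneD(2)[OF b] by simp
  have "conv a x - conv b x = (LINT y|lborel. k y * a (x - y) - k y * b (x - y))"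
    unfolding conv_def using i by simp
  also have "\<bar>\<dots>\<bar> \<le> (LINT y|lborel. \<bar>k y * a (x - y) - k y * b (x - y)\<bar>)"
    by (rule integral_abs_bound)
  also have "\<dots> \<le> (LINT y|lborel. C * \<bar>a (x - y) - b (x - y)\<bar>)"
  proof (rule integral_mono)
    show "integrable lborel (\<lambda>y. \<bar>k y * a (x - y) - k y * b (x - y)\<bar>)" using i by auto
    show "integrable lborel (\<lambda>y. C * \<bar>a (x - y) - b (x - y)\<bar>)"
      using integrable_lborel_reflect[OF iab] by auto
    show "\<bar>k y * a (x - y) - k y * b (x - y)\<bar> \<le> C * \<bar>a (x - y) - b (x - y)\<bar>" for y
      using k_nonneg[of y] k_le[of y]
      by (simp add: right_diff_distrib[symmetric] abs_mult mult_right_mono)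
  qed
  also have "\<dots> = C * (LINT y|lborel. \<bar>a y - b y\<bar>)"
    using integral_lborel_reflect[of "\<lambda>y. \<bar>a y - b y\<bar>" x] by simp
  finally show ?thesis using l1_dist_lborel[OF a b] by simp
qed

text \<open>By Tonelli the integral of \<open>conv a\<close> is the product of the integrals of
  \<open>k\<close> and \<open>a\<close>, hence finite; Markov's inequality does the rest.\<close>

lemma conv_superlevel_finite:
  assumes a: "a \<in> A_one" and c: "0 < c"
  shows "emeasure lborel {x. c \<le> conv a x} < \<infinity>"
proof -
  note [measurable] = A_oneD(1)[OF a]
  have i: "integrable lborel (\<lambda>y. k y * a (x - y))" for x
    using A_oneD(4,5)[OF a] by (auto intro!: integrable_conv)
  have ka: "0 \<le> k y * a (x - y)" for x y using k_nonneg A_oneD(4)[OF a] by simp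
  have "(\<integral>\<^sup>+x. ennreal (conv a x) \<partial>lborel)
      = (\<integral>\<^sup>+x. (\<integral>\<^sup>+y. ennreal (k y * a (x - y)) \<partial>lborel) \<partial>lborel)"
    unfolding conv_def using i ka by (simp add: nn_integral_eq_integral)
  also have "\<dots> = (\<integral>\<^sup>+y. (\<integral>\<^sup>+x. ennreal (k y * a (x - y)) \<partial>lborel) \<partial>lborel)"
    by (rule lborel_pair.Fubini') measurable
  also have "\<dots> = (\<integral>\<^sup>+y. ennreal (k y) * (\<integral>\<^sup>+x. ennreal (a (x - y)) \<partial>lborel) \<partial>lborel)"
    using k_nonneg by (intro nn_integral_cong) (simp add: ennreal_mult' nn_integral_cmult)
  also have "\<dots> = (\<integral>\<^sup>+y. ennreal (k y) * (\<integral>\<^sup>+x. ennreal (a x) \<partial>lborel) \<partial>lborel)"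
    using nn_integral_lborel_shift[of "\<lambda>x. ennreal (a x)"] by simp
  also have "\<dots> = ennreal (LINT y|lborel. k y) * ennreal (LINT x|lborel. a x)"
    using k_nonneg k_integrable A_oneD(2,4)[OF a] by (simp add: nn_integral_multc nn_integral_eq_integral)
  also have "\<dots> < \<infinity>" by (simp add: ennreal_mult_less_top)
  finally have fin: "(\<integral>\<^sup>+x. ennreal (conv a x) \<partial>lborel) < \<infinity>" .
  have "{x. c \<le> conv a x} \<subseteq> {x \<in> UNIV. 1 \<le> ennreal (1 / c) * ennreal (conv a x)}"
  proof safe
    fix x assume "c \<le> conv a x"
    then have "1 \<le> 1 / c * conv a x" using c by (simp add: field_simps)
    then show "1 \<le> ennreal (1 / c) * ennreal (conv a x)"
      using c by (simp add: ennreal_mult'[symmetric])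
  qed simp
  then have "emeasure lborel {x. c \<le> conv a x}
      \<le> emeasure lborel {x \<in> UNIV. 1 \<le> ennreal (1 / c) * ennreal (conv a x)}"
    by (rule emeasure_mono) measurable
  also have "\<dots> \<le> ennreal (1 / c) * (\<integral>\<^sup>+x. ennreal (conv a x) * indicator UNIV x \<partial>lborel)"
    by (rule nn_integral_Markov_inequality) measurable
  also have "\<dots> < \<infinity>" using fin by (simp add: ennreal_mult_less_top)
  finally show ?thesis .
qed

text \<open>This is upper semicontinuity of the level mass. The sets \<open>L n\<close>, where
  \<open>conv a\<close> is within \<open>\<delta> n\<close> of \<open>F\<close>, shrink to the level
  set, so one of them has measure below \<open>r\<close>; by the uniform Lipschitz bound it contains
  the level set of every \<open>b\<close> close to \<open>a\<close>.\<close>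

lemma level_mass_stable:
  assumes F: "finite F" "\<And>c. c \<in> F \<Longrightarrow> c0 \<le> c" "0 < c0"
    and a: "a \<in> A_one" and less: "emeasure lborel {x. conv a x \<in> F} < r"
  obtains d where "0 < d"
    "\<And>b. b \<in> A_one \<Longrightarrow> l1_dist a b < d \<Longrightarrow> emeasure lborel {x. conv b x \<in> F} < r"
proof -
  note [measurable] = A_oneD(1)[OF a]
  have [measurable]: "F \<in> sets borel" using F(1) by (simp add: borel_closed finite_imp_closed)
  \<comment> \<open>The summand 2 gives \<open>\<delta> n \<le> c0 / 2\<close>, so every
    \<open>L n\<close> lies where \<open>conv a\<close> is at least \<open>c0 / 2\<close>. This set
    has finite measure, as continuity from above requires.\<close>
  define \<delta> where "\<delta> n = c0 / (real n + 2)" for n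
  have \<delta>pos: "0 < \<delta> n" for n using F(3) by (simp add: \<delta>_def)
  define L where "L n = (\<Union>c\<in>F. {x. \<bar>conv a x - c\<bar> \<le> \<delta> n})" for n
  have Lm[measurable]: "L n \<in> sets borel" for n
    unfolding L_def using F(1) by (intro sets.finite_UN) measurable
  have "(\<lambda>n. emeasure lborel (L n)) \<longlonglongrightarrow> emeasure lborel (\<Inter>n. L n)"
  proof (rule Lim_emeasure_decseq)
    show "range L \<subseteq> sets lborel" using Lm by auto
    show "decseq L"
    proof (rule decseq_SucI)
      fix n
      have "\<delta> (Suc n) \<le> \<delta> n" using F(3) by (simp add: \<delta>_def frac_le)
      then show "L (Suc n) \<subseteq> L n" unfolding L_def by fastforce
    qed
    fix n
    have "L n \<subseteq> {x. c0 / 2 \<le> conv a x}"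
    proof
      fix x assume "x \<in> L n"
      then obtain c where c: "c \<in> F" "\<bar>conv a x - c\<bar> \<le> \<delta> n" by (auto simp: L_def)
      have "\<delta> n \<le> c0 / 2" unfolding \<delta>_def using F(3) by (intro divide_left_mono) auto
      then show "x \<in> {x. c0 / 2 \<le> conv a x}" using c F(2)[OF c(1)] by auto
    qed
    then have "emeasure lborel (L n) \<le> emeasure lborel {x. c0 / 2 \<le> conv a x}"
      by (rule emeasure_mono) measurable
    then show "emeasure lborel (L n) \<noteq> \<infinity>"
      using conv_superlevel_finite[OF a, of "c0 / 2"] F(3) by auto
  qed
  \<comment> \<open>A value outside the closed set \<open>F\<close> has positive distance from it,
    which some \<open>\<delta> n\<close> undercuts.\<close>
  moreover have "(\<Inter>n. L n) \<subseteq> {x. conv a x \<in> F}"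
  proof (rule ccontr)
    assume "\<not> ?thesis"
    then obtain x where x: "\<And>n. x \<in> L n" "conv a x \<in> - F" by auto
    moreover have "open (- F)" using F(1) by (simp add: finite_imp_closed open_Compl)
    ultimately obtain e where e: "0 < e" "ball (conv a x) e \<subseteq> - F"
      using open_contains_ball by metis
    obtain n where n: "c0 / e < real n" using reals_Archimedean2 by blast
    then have "c0 < real n * e" using e by (simp add: field_simps)
    then have "\<delta> n < e" using e by (simp add: \<delta>_def field_simps)
    moreover obtain c where "c \<in> F" "\<bar>conv a x - c\<bar> \<le> \<delta> n" using x(1)[of n] by (auto simp: L_def)
    ultimately show False using e by (auto simp: dist_real_def subset_iff)
  qed
  then have "emeasure lborel (\<Inter>n. L n) \<le> emeasure lborel {x. conv a x \<in> F}"
    by (rule emeasure_mono) measurable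
  then have "emeasure lborel (\<Inter>n. L n) < r" using less by (rule le_less_trans)
  ultimately have "\<forall>\<^sub>F n in sequentially. emeasure lborel (L n) < r" by (rule order_tendstoD)
  then obtain n where n: "emeasure lborel (L n) < r" by (auto simp: eventually_sequentially)
  show thesis
  proof
    \<comment> \<open>Dividing by \<open>C + 1\<close> instead of \<open>C\<close> covers the case
      \<open>C = 0\<close>.\<close>
    show "0 < \<delta> n / (C + 1)" using \<delta>pos C_nonneg by simp
    fix b assume b: "b \<in> A_one" and d: "l1_dist a b < \<delta> n / (C + 1)"
    have "(C + 1) * l1_dist a b \<le> \<delta> n" using d C_nonneg by (simp add: field_simps)
    moreover have "0 \<le> l1_dist a b" by (simp add: l1_dist_def)
    ultimately have "C * l1_dist a b \<le> \<delta> n" by (simp add: algebra_simps)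
    then have "{x. conv b x \<in> F} \<subseteq> L n"
      using conv_diff_le[OF a b] unfolding L_def by (blast intro: order_trans)
    then have "emeasure lborel {x. conv b x \<in> F} \<le> emeasure lborel (L n)"
      by (rule emeasure_mono) simp
    then show "emeasure lborel {x. conv b x \<in> F} < r" using n by (rule le_less_trans)
  qed
qed

text \<open>If \<open>U\<close> contributes at \<open>x\<close>, the open set \<open>V\<close> of
  points of \<open>U\<close> that \<open>x - P\<close> reaches is nonempty. Then \<open>B\<close>
  meets \<open>V\<close> in positive measure, and after reflection \<open>k\<close> is positive
  almost everywhere on that part.\<close>

lemma conv_indicator_pos:
  assumes P: "open P" "AE y in lborel. y \<in> P \<longrightarrow> 0 < k y" "AE y in lborel. y \<notin> P \<longrightarrow> k y = 0"
    and U: "open U" and B[measurable]: "B \<in> sets borel"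
    and meets: "\<And>V. open V \<Longrightarrow> V \<noteq> {} \<Longrightarrow> 0 < emeasure lborel (V \<inter> B)"
    and nz: "conv (indicator U) x \<noteq> 0"
  shows "0 < conv (indicator (U \<inter> B)) x"
proof -
  have [measurable]: "P \<in> sets borel" "U \<in> sets borel" using P U by auto
  define V where "V = U \<inter> (\<lambda>z. x - z) -` P"
  have "open V" unfolding V_def
    using P(1) U by (intro open_Int open_vimage continuous_intros)
  moreover have "V \<noteq> {}"
  proof
    \<comment> \<open>Then \<open>x - y\<close> is outside \<open>U\<close> for every
      \<open>y\<close> in \<open>P\<close>, while \<open>k\<close> vanishes almost everywhere off
      \<open>P\<close>.\<close>
    assume V: "V = {}"
    have "AE y in lborel. k y * indicator U (x - y) = 0"
      using P(3)
    proof eventually_elim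
      case (elim y)
      have "x - y \<notin> U" if "y \<in> P" using V that unfolding V_def by (auto simp: set_eq_iff)
      then show ?case using elim by (auto simp: indicator_def)
    qed
    then have "conv (indicator U) x = 0" unfolding conv_def by (rule integral_eq_zero_AE)
    then show False using nz by simp
  qed
  ultimately have pos: "0 < emeasure lborel {y. x - y \<in> V \<inter> B}"
    using meets by (subst emeasure_lborel_reflect) auto
  have i: "integrable lborel (\<lambda>y. k y * indicator (U \<inter> B) (x - y))"
    by (rule integrable_conv) (auto simp: indicator_def)
  have nn: "0 \<le> k y * indicator (U \<inter> B) (x - y)" for y using k_nonneg by simp
  have "conv (indicator (U \<inter> B)) x \<noteq> 0"
  proof
    assume "conv (indicator (U \<inter> B)) x = 0"
    then have "AE y in lborel. k y * indicator (U \<inter> B) (x - y) = 0"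
      unfolding conv_def using integral_nonneg_eq_0_iff_AE[OF i] nn by auto
    then have "AE y in lborel. y \<notin> {y. x - y \<in> V \<inter> B}"
      using P(2) by eventually_elim (auto simp: V_def indicator_def)
    moreover have [measurable]: "V \<in> sets borel" using \<open>open V\<close> by simp
    have "{y. x - y \<in> V \<inter> B} \<in> sets lborel" by measurable
    ultimately show False using pos AE_iff_measurable[of "{y. x - y \<in> V \<inter> B}" lborel] by auto
  qed
  moreover have "0 \<le> conv (indicator (U \<inter> B)) x"
    unfolding conv_def using nn by simp
  ultimately show ?thesis by simp
qed


text \<open>The error \<open>e\<close> is split evenly: \<open>e / 2\<close> for enlarging the
  support of \<open>a\<close> to an open set \<open>U\<close>, and \<open>e / 2\<close> for the
  removed set \<open>S t\<close>. All but countably many \<open>t\<close> make every level in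
  \<open>F\<close> null.\<close>

lemma null_level_approximation:
  assumes P: "open P" "AE y in lborel. y \<in> P \<longrightarrow> 0 < k y" "AE y in lborel. y \<notin> P \<longrightarrow> k y = 0"
    and F: "finite F" "\<And>c. c \<in> F \<Longrightarrow> 0 < c" and a: "a \<in> A_one" and e: "0 < e"
  obtains b where "b \<in> A_one" "l1_dist a b < e" "emeasure lborel {x. conv b x \<in> F} = 0"
proof -
  note [measurable] = A_oneD(1)[OF a]
  define A where "A = {x. a x = 1}"
  have A[measurable]: "A \<in> sets borel" unfolding A_def by measurable
  have aA: "a = indicator A"
    using A_oneD(3)[OF a] by (auto simp: A_def indicator_def fun_eq_iff)
  have Afin: "emeasure lborel A < \<infinity>"
    using A_oneD(2)[OF a] unfolding aA by (subst (asm) integrable_indicator_iff) auto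
  obtain U where U: "open U" "A \<subseteq> U" "emeasure lborel (U - A) < ennreal (e / 2)"
    using outer_regular_lborel[OF A, of "e / 2"] e by auto
  have [measurable]: "U \<in> sets borel" using U by simp
  have "emeasure lborel U \<le> emeasure lborel A + emeasure lborel (U - A)"
    using U(2) by (subst plus_emeasure) (auto simp: Un_absorb1)
  also have "\<dots> < \<infinity>" using Afin U(3) by (auto simp: less_top[symmetric] top_unique)
  finally have Ufin: "emeasure lborel U < \<infinity>" .
  have Usub: "emeasure lborel B < \<infinity>" if "B \<subseteq> U" for B
    using emeasure_mono[OF that, of lborel] Ufin by (auto intro: le_less_trans)
  obtain S :: "real \<Rightarrow> (real ^ 'n) set" where S[measurable]: "\<And>t. S t \<in> sets borel"
    and Se: "\<And>t. emeasure lborel (S t) \<le> ennreal (e / 2)"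
    and Smono: "\<And>s t. s \<le> t \<Longrightarrow> S s \<subseteq> S t"
    and Sstrict: "\<And>s t V. s < t \<Longrightarrow> open V \<Longrightarrow> V \<noteq> {} \<Longrightarrow> 0 < emeasure lborel (V \<inter> (S t - S s))"
    using ex_strict_chain[of "e / 2"] e by auto
  define b :: "real \<Rightarrow> real ^ 'n \<Rightarrow> real" where "b t = indicator (U - S t)" for t
  have bA: "b t \<in> A_one" for t
    unfolding b_def by (intro indicator_in_A_one Usub) auto
  have UA: "indicator U \<in> A_one" using Ufin by (intro indicator_in_A_one) auto
  have conv_le: "conv (b t) x \<le> conv (indicator U) x" for t x
    unfolding conv_def b_def
    by (intro integral_mono integrable_conv mult_left_mono k_nonneg) (auto simp: indicator_def)
  have strict: "conv (b t) x < conv (b s) x" if "s < t" and pos: "0 < conv (b t) x" for s t x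
  proof -
    have "0 < conv (indicator (U \<inter> (S t - S s))) x"
      using conv_le[of t x] pos
      by (intro conv_indicator_pos[OF P U(1)] Sstrict[OF that(1)]) auto
    \<comment> \<open>\<open>U - S s\<close> is the disjoint union of \<open>U - S t\<close> and
      \<open>U \<inter> (S t - S s)\<close>, because \<open>S s \<subseteq> S t\<close>.\<close>
    moreover have "conv (b s) x = (LINT y|lborel. k y * b t (x - y)
        + k y * indicator (U \<inter> (S t - S s)) (x - y))"
      unfolding conv_def
      using Smono[OF less_imp_le[OF that(1)]]
      by (intro Bochner_Integration.integral_cong) (auto simp: b_def indicator_def)
    then have "conv (b s) x = conv (b t) x + conv (indicator (U \<inter> (S t - S s))) x"
      unfolding conv_def b_def
      by (subst (asm) Bochner_Integration.integral_add) (auto intro!: integrable_conv simp: indicator_def)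
    ultimately show ?thesis by simp
  qed
  have "countable {t. emeasure lborel {x. conv (b t) x = c} \<noteq> 0}" if c: "c \<in> F" for c
  proof -
    have "countable {t \<in> UNIV. emeasure lborel {x. conv (b t) x = c} \<noteq> 0}"
    proof (rule countable_nonnull_disjoint_family)
      show "{x. conv (b t) x = c} \<in> sets lborel" for t
        using A_oneD(1)[OF bA[of t]] by measurable
      \<comment> \<open>A single set of finite measure contains the level sets for all
        \<open>t\<close>, because \<open>b t\<close> never exceeds the indicator of
        \<open>U\<close>.\<close>
      show "{x. conv (b t) x = c} \<subseteq> {x. c \<le> conv (indicator U) x}" for t
        using conv_le by auto
      show "{x. c \<le> conv (indicator U) x} \<in> sets lborel" by measurable
      show "emeasure lborel {x. c \<le> conv (indicator U) x} \<noteq> \<infinity>"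
        using conv_superlevel_finite[OF UA F(2)[OF c]] by simp
      \<comment> \<open>Since \<open>c > 0\<close>, a common point would have positive values at
        both parameters, where strict monotonicity separates them.\<close>
      have "conv (b t) x \<noteq> c" if "conv (b s) x = c" "s \<noteq> t" for s t x
        using strict[of s t x] strict[of t s x] that F(2)[OF c] by (cases "s < t") auto
      then show "disjoint_family_on (\<lambda>t. {x. conv (b t) x = c}) UNIV"
        by (auto simp: disjoint_family_on_def)
    qed
    then show ?thesis by simp
  qed
  then have "countable (\<Union>c\<in>F. {t. emeasure lborel {x. conv (b t) x = c} \<noteq> 0})"
    using F(1) by (intro countable_UN[OF countable_finite]) auto
  then have "(\<Union>c\<in>F. {t. emeasure lborel {x. conv (b t) x = c} \<noteq> 0}) \<noteq> UNIV"
    using uncountable_UNIV_real by metis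
  then obtain t where t: "\<And>c. c \<in> F \<Longrightarrow> emeasure lborel {x. conv (b t) x = c} = 0" by blast
  have [measurable]: "b t \<in> borel_measurable borel" by (rule A_oneD(1)[OF bA])
  have "{x. conv (b t) x = c} \<in> null_sets lborel" if "c \<in> F" for c
    using t[OF that] by (intro null_setsI) measurable
  then have "(\<Union>c\<in>F. {x. conv (b t) x = c}) \<in> null_sets lborel"
    using F(1) by (intro null_sets_UN' countable_finite) auto
  moreover have "(\<Union>c\<in>F. {x. conv (b t) x = c}) = {x. conv (b t) x \<in> F}" by auto
  ultimately have "emeasure lborel {x. conv (b t) x \<in> F} = 0" by auto
  moreover have "l1_dist a (b t) < e"
  proof -
    have fin: "emeasure lborel (U - A) < \<infinity>" "emeasure lborel (U \<inter> S t) < \<infinity>"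
      by (intro Usub; blast)+
    have "l1_dist a (b t) = (LINT x|lborel. \<bar>a x - b t x\<bar>)" by (rule l1_dist_lborel[OF a bA])
    \<comment> \<open>As \<open>A \<subseteq> U\<close>, the functions \<open>a\<close> and
      \<open>b t\<close> differ only at added points, in \<open>U - A\<close>, or at removed ones,
      in \<open>U \<inter> S t\<close>.\<close>
    also have "\<dots> \<le> (LINT x|lborel. indicator (U - A) x + indicator (U \<inter> S t) x)"
    proof (rule integral_mono)
      show "integrable lborel (\<lambda>x. \<bar>a x - b t x\<bar>)" using A_oneD(2)[OF a] A_oneD(2)[OF bA] by simp
      show "integrable lborel (\<lambda>x. indicator (U - A) x + indicator (U \<inter> S t) x :: real)"
        using fin by (intro Bochner_Integration.integrable_add integrable_real_indicator) auto
      show "\<bar>a x - b t x\<bar> \<le> indicator (U - A) x + indicator (U \<inter> S t) x" for x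
        using U(2) by (auto simp: aA b_def indicator_def)
    qed
    also have "\<dots> = measure lborel (U - A) + measure lborel (U \<inter> S t)"
      using fin by (subst Bochner_Integration.integral_add) (auto intro!: integrable_real_indicator)
    also have "measure lborel (U - A) < e / 2"
      using U(3) fin(1)
      by (subst (asm) emeasure_eq_ennreal_measure) (auto simp: ennreal_less_iff)
    also have "emeasure lborel (U \<inter> S t) \<le> ennreal (e / 2)"
      using emeasure_mono[of "U \<inter> S t" "S t" lborel] Se[of t] by (auto intro: order_trans)
    then have "measure lborel (U \<inter> S t) \<le> e / 2"
      unfolding measure_def using e by (intro enn2real_leI) auto
    finally show ?thesis by simp
  qed
  ultimately show thesis using that bA by blast
qed

end

section \<open>Shifts\<close>

lemma shift_in_A_one:
  assumes a: "a \<in> A_one"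
  shows "shift v a \<in> A_one"
proof -
  note [measurable] = A_oneD(1)[OF a]
  have m[measurable]: "shift v a \<in> borel_measurable borel" unfolding shift_def by measurable
  have "integrable (distr lborel borel ((+) v)) a" using A_oneD(2)[OF a] by (simp add: lborel_distr_plus)
  then have "integrable lborel (shift v a)"
    by (subst (asm) integrable_distr_eq) (auto simp: shift_def add.commute)
  then show ?thesis
    using A_oneD(3)[OF a] m by (auto simp: A_one_def A_all_def integrable_completion shift_def)
qed

lemma shift_ae_rel:
  assumes "(a, b) \<in> ae_rel"
  shows "(shift v a, shift v b) \<in> ae_rel"
proof -
  have A: "a \<in> A_one" "b \<in> A_one" and ae: "AE x in lborel. a x = b x"
    using assms by (auto simp: ae_rel_def AE_completion_iff)
  note [measurable] = A_oneD(1)[OF A(1)] A_oneD(1)[OF A(2)]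
  have "AE x in distr lborel borel ((+) v). a x = b x" using ae lborel_distr_plus[of v] by metis
  then have "AE x in lborel. shift v a x = shift v b x"
    by (subst (asm) AE_distr_iff) (auto simp: shift_def add.commute)
  then show ?thesis using A shift_in_A_one by (auto simp: ae_rel_def AE_completion_iff)
qed

lemma shift_shift: "shift v (shift w a) = shift (v + w) a"
  by (simp add: shift_def add_ac)

lemma shift_0: "shift 0 a = a"
  by (simp add: shift_def)

text \<open>Shifting by \<open>- v\<close> inverts shifting by \<open>v\<close>, so closure of
  \<open>S\<close> under all shifts upgrades from inclusion to equality.\<close>

lemma shift_invariant_quotient:
  fixes S :: "(real ^ 'n \<Rightarrow> real) set"
  assumes S: "\<And>v a. a \<in> S \<Longrightarrow> shift v a \<in> S"
  shows "shift_invariant (S // ae_rel)"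
proof -
  \<comment> \<open>Both \<open>shift v\<close> and its inverse preserve \<open>ae_rel\<close>, so
    the image of a class is again a whole class.\<close>
  have cls: "shift v ` (ae_rel `` {a}) = ae_rel `` {shift v a}" for v and a :: "real ^ 'n \<Rightarrow> real"
  proof
    show "shift v ` (ae_rel `` {a}) \<subseteq> ae_rel `` {shift v a}" using shift_ae_rel by auto
    show "ae_rel `` {shift v a} \<subseteq> shift v ` (ae_rel `` {a})"
    proof
      fix c assume "c \<in> ae_rel `` {shift v a}"
      then have "(a, shift (- v) c) \<in> ae_rel"
        using shift_ae_rel[of "shift v a" c "- v"] by (simp add: shift_shift shift_0)
      moreover have "c = shift v (shift (- v) c)" by (simp add: shift_shift shift_0)
      ultimately show "c \<in> shift v ` (ae_rel `` {a})" by blast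
    qed
  qed
  have img: "shift v ` X \<in> S // ae_rel" if X: "X \<in> S // ae_rel" for v X
  proof -
    obtain a where "a \<in> S" "X = ae_rel `` {a}" using X by (rule quotientE)
    then show ?thesis using S cls by (simp add: quotientI)
  qed
  have "X \<in> (\<lambda>X. shift v ` X) ` (S // ae_rel)" if X: "X \<in> S // ae_rel" for v X
  proof
    show "X = shift v ` (shift (- v) ` X)" by (simp add: image_image shift_shift shift_0)
  qed (rule img[OF X])
  then show ?thesis using img by (auto simp: shift_invariant_def)
qed

text \<open>Convolution commutes with shifts, so the level set is translated. The Borel function
  \<open>f\<close> serves to make that set Borel.\<close>

lemma level_mass_shift:
  assumes \<kappa>: "\<And>x. convol \<kappa> a x = f x" and [measurable]: "f \<in> borel_measurable borel"
  shows "level_mass \<kappa> \<theta> (shift v a) = level_mass \<kappa> \<theta> a"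
proof -
  obtain s0 b0 b1 s1 where \<theta>: "\<theta> = (s0, b0, b1, s1)" by (cases \<theta>)
  define B where "B = {x. f x \<in> {s0, b0, b1, s1}}"
  have [measurable]: "B \<in> sets borel" unfolding B_def by measurable
  have "convol \<kappa> (shift v a) x = f (x + v)" for x
    unfolding \<kappa>[symmetric] by (simp add: convol_def shift_def algebra_simps)
  then have "level_mass \<kappa> \<theta> (shift v a) = emeasure lebesgue {x. x + v \<in> B}"
    by (simp add: \<theta> level_mass_def B_def)
  also have "\<dots> = emeasure lborel {x. x + v \<in> B}" by simp
  also have "\<dots> = emeasure lborel B" by (rule emeasure_lborel_shift) measurable
  also have "\<dots> = level_mass \<kappa> \<theta> a" by (simp add: \<theta> level_mass_def B_def \<kappa>)
  finally show ?thesis .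
qed

section \<open>Shift invariance, density and the G-delta property in the space of classes\<close>

theorem theorem1p2:
  fixes \<kappa> :: "real ^ 'n \<Rightarrow> real" and \<theta> :: "real \<times> real \<times> real \<times> real"
  assumes "\<theta> \<in> Theta" and "\<kappa> \<in> kernels" and "almost_continuous \<kappa>"
  shows "shift_invariant (A_zero \<kappa> \<theta> // ae_rel)
    \<and> A_one_topology closure_of (A_zero \<kappa> \<theta> // ae_rel) = A_one // ae_rel
    \<and> gdelta_in A_one_topology (A_zero \<kappa> \<theta> // ae_rel)"
proof -
  obtain k C where k: "k \<in> borel_measurable borel" "\<And>x. 0 \<le> k x" "\<And>x. k x \<le> C"
    "integrable lborel k" and \<kappa>k: "AE x in lborel. \<kappa> x = k x"
    using bounded_kernel_version[OF assms(2)] by metis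
  interpret bounded_kernel k C using k by unfold_locales
  obtain P where P: "open P" "\<And>x. x \<in> P \<Longrightarrow> 0 < \<kappa> x" "AE x in lborel. x \<notin> P \<longrightarrow> \<kappa> x = 0"
    using almost_continuous_kernel_support[OF assms(2,3)] by metis
  have kP: "AE x in lborel. x \<in> P \<longrightarrow> 0 < k x"
    using \<kappa>k by eventually_elim (use P(2) in fastforce)
  have k0: "AE x in lborel. x \<notin> P \<longrightarrow> k x = 0" using \<kappa>k P(3) by eventually_elim simp
  obtain s0 b0 b1 s1 where \<theta>: "\<theta> = (s0, b0, b1, s1)" by (cases \<theta>)
  define F where "F = {s0, b0, b1, s1}"
  have F: "finite F" "0 < s0" "\<And>c. c \<in> F \<Longrightarrow> s0 \<le> c"
    using assms(1) by (auto simp: F_def \<theta> Theta_def)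
  then have Fpos: "0 < c" if "c \<in> F" for c using that by force
  define m where "m a = emeasure lborel {x. conv a x \<in> F}" for a
  have convol: "convol \<kappa> a x = conv a x" if "a \<in> A_one" for a x
    unfolding conv_def using assms(2) \<kappa>k
    by (intro convol_lborel_cong A_oneD(1)[OF that]) (auto simp: kernels_def)
  have mass: "level_mass \<kappa> \<theta> a = m a" if a: "a \<in> A_one" for a
  proof -
    have [measurable]: "{x. conv a x \<in> F} \<in> sets borel"
      unfolding F_def using A_oneD(1)[OF a] by measurable
    have "level_mass \<kappa> \<theta> a = emeasure lebesgue {x. conv a x \<in> F}"
      by (simp add: \<theta> level_mass_def convol[OF a] F_def)
    then show ?thesis by (simp add: m_def)
  qed
  let ?Q = "A_one // ae_rel :: (real ^ 'n \<Rightarrow> real) set set"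
  interpret Q: Metric_space ?Q class_dist by (rule Metric_space_A_one)
  have mem: "a \<in> A_one" if "X \<in> ?Q" "a \<in> X" for X a
    using that by (auto simp: quotient_def ae_rel_def)
  have nonempty: "\<exists>a. a \<in> X" if "X \<in> ?Q" for X
    using that equiv_ae_rel in_quotient_imp_non_empty by blast
  have cls: "X = ae_rel `` {a}" if "X \<in> ?Q" "a \<in> X" for X a
    using that equiv_ae_rel by (metis Image_singleton_iff equiv_class_eq quotientE)
  \<comment> \<open>Representatives have distance 0, so the Lipschitz bound makes their convolutions
    equal at every point.\<close>
  have m_cong: "m a = m b" if "X \<in> ?Q" "a \<in> X" "b \<in> X" for X a b
  proof -
    have "l1_dist a b = 0" using class_dist_eq[OF that(1,1,2,3)] Q.zero[OF that(1,1)] by simp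
    then have "conv a x = conv b x" for x
      using conv_diff_le[OF mem[OF that(1,2)] mem[OF that(1,3)], of x] by simp
    then show ?thesis by (simp add: m_def)
  qed
  have zero_iff: "X \<in> A_zero \<kappa> \<theta> // ae_rel \<longleftrightarrow> X \<in> ?Q \<and> (\<exists>a\<in>X. m a = 0)" for X
  proof
    assume "X \<in> A_zero \<kappa> \<theta> // ae_rel"
    then obtain a where a: "a \<in> A_zero \<kappa> \<theta>" "X = ae_rel `` {a}" by (rule quotientE)
    then have "a \<in> A_one" "m a = 0" using mass by (auto simp: A_zero_def)
    then show "X \<in> ?Q \<and> (\<exists>a\<in>X. m a = 0)"
      using a equiv_ae_rel by (metis equiv_class_self quotientI)
  next
    assume X: "X \<in> ?Q \<and> (\<exists>a\<in>X. m a = 0)"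
    then obtain a where a: "a \<in> X" "m a = 0" by auto
    then have "a \<in> A_zero \<kappa> \<theta>" using X mem mass by (auto simp: A_zero_def)
    then show "X \<in> A_zero \<kappa> \<theta> // ae_rel" using X a cls by (metis quotientI)
  qed
  have "shift v a \<in> A_zero \<kappa> \<theta>" if "a \<in> A_zero \<kappa> \<theta>" for v a
  proof -
    have a: "a \<in> A_one" using that by (simp add: A_zero_def)
    then show ?thesis
      using that level_mass_shift[OF convol[OF a] measurable_conv[OF A_oneD(1)[OF a]]]
      by (simp add: A_zero_def shift_in_A_one)
  qed
  then have inv: "shift_invariant (A_zero \<kappa> \<theta> // ae_rel)" by (rule shift_invariant_quotient)
  have dense: "A_one_topology closure_of (A_zero \<kappa> \<theta> // ae_rel) = ?Q"
  proof -
    have "\<exists>Y \<in> A_zero \<kappa> \<theta> // ae_rel. Y \<in> Q.mball X r" if X: "X \<in> ?Q" and r: "0 < r" for X r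
    proof -
      obtain a where a: "a \<in> X" using nonempty[OF X] by auto
      obtain b where b: "b \<in> A_one" "l1_dist a b < r" "m b = 0"
        using null_level_approximation[OF P(1) kP k0 F(1) Fpos mem[OF X a] r] unfolding m_def by metis
      define Y where "Y = ae_rel `` {b}"
      have Y: "Y \<in> ?Q" "b \<in> Y"
        using b(1) equiv_class_self[OF equiv_ae_rel b(1)] by (auto simp: Y_def quotientI)
      then have "class_dist X Y < r" using class_dist_eq[OF X Y(1) a Y(2)] b by simp
      then show ?thesis using X Y b(3) zero_iff by (auto simp: Q.in_mball)
    qed
    then show ?thesis unfolding Q.metric_closure_of by auto
  qed
  \<comment> \<open>Upper semicontinuity makes these strict sublevel sets open, and their
    intersection consists of the classes of mass 0.\<close>
  define G where "G n = {X \<in> ?Q. \<exists>a\<in>X. m a < ennreal (inverse (real (Suc n)))}" for n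
  have "openin A_one_topology (G n)" for n
    unfolding Q.openin_mtopology
  proof (intro conjI allI impI)
    show "G n \<subseteq> ?Q" by (auto simp: G_def)
    fix X assume "X \<in> G n"
    then obtain a where X: "X \<in> ?Q" "a \<in> X" and less: "m a < ennreal (inverse (real (Suc n)))"
      by (auto simp: G_def)
    obtain d where d: "0 < d"
      "\<And>b. b \<in> A_one \<Longrightarrow> l1_dist a b < d \<Longrightarrow> m b < ennreal (inverse (real (Suc n)))"
      using level_mass_stable[OF F(1,3,2) mem[OF X]] less unfolding m_def by metis
    have "Q.mball X d \<subseteq> G n"
    proof
      fix Y assume "Y \<in> Q.mball X d"
      then have Y: "Y \<in> ?Q" "class_dist X Y < d" by (auto simp: Q.in_mball)
      obtain b where b: "b \<in> Y" using nonempty[OF Y(1)] by auto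
      then have "m b < ennreal (inverse (real (Suc n)))"
        using d(2)[OF mem[OF Y(1) b]] Y class_dist_eq[OF X(1) Y(1) X(2) b] by simp
      then show "Y \<in> G n" using Y b by (auto simp: G_def)
    qed
    then show "\<exists>r>0. Q.mball X r \<subseteq> G n" using d(1) by blast
  qed
  then have "gdelta_in A_one_topology (\<Inter>(range G))"
    by (intro gdelta_in_Inter) (auto intro: open_imp_gdelta_in)
  moreover have "\<Inter>(range G) = A_zero \<kappa> \<theta> // ae_rel"
  proof (intro set_eqI iffI)
    fix X assume X: "X \<in> \<Inter>(range G)"
    then have XQ: "X \<in> ?Q" by (auto simp: G_def)
    obtain a where a: "a \<in> X" using nonempty[OF XQ] by auto
    \<comment> \<open>The witness in \<open>G n\<close> may vary with \<open>n\<close>;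
      \<open>m_cong\<close> transfers the bound to the fixed representative
      \<open>a\<close>.\<close>
    have "m a < ennreal (inverse (real (Suc n)))" for n
      using X m_cong[OF XQ a] by (auto simp: G_def)
    moreover have "(\<lambda>n. ennreal (inverse (real (Suc n)))) \<longlonglongrightarrow> ennreal 0"
      by (intro tendsto_ennrealI LIMSEQ_inverse_real_of_nat)
    ultimately have "m a \<le> ennreal 0"
      by (intro LIMSEQ_le_const) (auto intro: less_imp_le)
    then show "X \<in> A_zero \<kappa> \<theta> // ae_rel" using XQ a zero_iff by auto
  next
    fix X assume "X \<in> A_zero \<kappa> \<theta> // ae_rel"
    then obtain a where "X \<in> ?Q" "a \<in> X" "m a = 0" using zero_iff by blast
    then show "X \<in> \<Inter>(range G)" by (auto simp: G_def intro!: bexI[of _ a])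
  qed
  ultimately show ?thesis using inv dense by simp
qed

end
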